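(* Let $p$ be an odd prime. If $p\equiv 1\pmod 4$ and $x,y$ are integers with $p=x^2+4y^2$ (such integers exist), then $$\sum_{k=0}^{p-1}\binom{2k}{k}\frac{S_k}{16^k}\equiv 4x^2\pmod p.$$ If $p\equiv 3\pmod 4$, then $$\sum_{k=0}^{p-1}\binom{2k}{k}\frac{S_k}{16^k}\equiv 0\pmod p.$$
   Context: For nonnegative integers $n$, $S_n=\sum_{k=0}^n\binom{n}{k}\binom{2k}{k}\binom{2n-2k}{n-k}$. Congruences modulo $p$ are taken in the ring of rational numbers whose denominator is not divisible by $p$. *)

theory Defs
  imports Complex_Main "HOL-Number_Theory.Cong"
begin

definition S :: "nat \<Rightarrow> nat" where
  "S n = (\<Sum>k=0..n. (n choose k) * ((2 * k) choose k) * ((2 * n - 2 * k) choose (n - k)))"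

(* The ring of rationals whose (reduced) denominator is not divisible by p. *)
definition p_integers :: "nat \<Rightarrow> rat set" where
  "p_integers p = {r. \<not> int p dvd snd (quotient_of r)}"

(* Congruence modulo the ideal generated by p in that ring; in particular both sides
   are required to lie in the ring. *)
definition rat_cong :: "nat \<Rightarrow> rat \<Rightarrow> rat \<Rightarrow> bool" where
  "rat_cong p a b \<longleftrightarrow>
     a \<in> p_integers p \<and> b \<in> p_integers p \<and> (\<exists>c \<in> p_integers p. a - b = of_nat p * c)"

end

theory Submission
  imports Defs "HOL-Computational_Algebra.Formal_Power_Series" "HOL-Number_Theory.Number_Theory"
begin

text \<open>Write \<open>p = 2 m + 1\<close>. The proof turns the sum into one binomial coefficient and then evaluates the
  square of that coefficient by a theorem of Gauss.

  \<^bold>\<open>Collapse of the sum.\<close> The exponential generating function of the central binomial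
  coefficients is \<open>exp (2 X) * I\<close>, where \<open>I\<close> is the sum of \<open>X^(2 j) / (j!)^2\<close>. Since
  \<open>S\<close> is the binomial convolution of the central binomial coefficients with themselves, its
  generating function is \<open>exp (4 X) * I^2\<close>, and \<open>I^2\<close> is the generating function of the sequence that is
  \<open>(2 j choose j)^2\<close> at \<open>2 j\<close> and \<open>0\<close> at odd indices. Multiplying by \<open>exp (- 4 X)\<close> shows
  that \<open>\<Sum>k\<le>m. (m choose k) * (- 4)^(m - k) * S k\<close> is \<open>(m choose (m div 2))^2\<close> for even \<open>m\<close> and \<open>0\<close> for
  odd \<open>m\<close> (\<open>S_binomial_inversion\<close>). Modulo \<open>p\<close> the given sum has this form up to the factor
  \<open>(- 4)^(3 m)\<close>, which is congruent to \<open>1\<close> for even \<open>m\<close>, because \<open>2 k choose k\<close> is congruent to \<open>(- 4)^k * (m choose k)\<close> for \<open>k < p\<close>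
  (\<open>central_binomial_cong\<close>). For \<open>p\<close> congruent to \<open>3\<close> modulo \<open>4\<close> the number \<open>m\<close> is odd and this
  is the claim.

  \<^bold>\<open>Gauss's congruence.\<close> Let \<open>m\<close> be even and let \<open>\<chi>\<close> be the quadratic character modulo \<open>p\<close>. The Jacobsthal
  sum \<open>J a = \<Sum>x. \<chi> x * \<chi> (x^2 + a)\<close> satisfies \<open>J (a k^2) = \<chi> k * J a\<close>, so \<open>(J a)^2\<close> takes
  only two values for nonzero \<open>a\<close>; their sum follows from the second moment \<open>\<Sum>a. (J a)^2\<close>, with the
  result that \<open>(J 1)^2 + (J n)^2 = 4 p\<close> for a nonresidue \<open>n\<close> (\<open>jacobsthal_sum_two_squares\<close>).
  Pairing \<open>x\<close> with \<open>- x\<close> gives \<open>J 1 = 2 a\<close> and \<open>J n = 2 b\<close>, hence \<open>p = a^2 + b^2\<close>, and \<open>a\<close> is odd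
  (\<open>odd_half_jacobsthal_1\<close>). On the other hand Euler's criterion and power sums modulo \<open>p\<close> give that \<open>J 1\<close> is
  congruent to \<open>- (m choose (m div 2))\<close> (\<open>jacobsthal_1_cong\<close>), so the square of this
  coefficient is congruent to \<open>4 a^2\<close>. This yields a representation of \<open>p\<close>, and since
  the representation as a sum of two squares is unique up to signs once the parities are fixed
  (\<open>sum_two_squares_unique\<close>), \<open>a^2 = x^2\<close> for every \<open>x\<close> and \<open>y\<close> with \<open>p = x^2 + 4 y^2\<close>.\<close>

section \<open>Exponential generating functions and the inversion formula for S\<close>

unbundle fps_syntax

definition egf :: "(nat \<Rightarrow> rat) \<Rightarrow> rat fps" where
  "egf f = Abs_fps (\<lambda>n. f n / fact n)"

lemma egf_nth: "egf f $ n = f n / fact n"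
  by (simp add: egf_def)

lemma egf_mult: "egf f * egf g = egf (\<lambda>n. \<Sum>k\<le>n. of_nat (n choose k) * f k * g (n - k))"
proof (rule fps_ext)
  fix n
  have "f k / fact k * (g (n - k) / fact (n - k)) = of_nat (n choose k) * f k * g (n - k) / fact n"
    if "k \<le> n" for k
    using that by (simp add: binomial_fact field_simps)
  thus "(egf f * egf g) $ n = egf (\<lambda>n. \<Sum>k\<le>n. of_nat (n choose k) * f k * g (n - k)) $ n"
    by (simp add: egf_nth fps_mult_nth atLeast0AtMost sum_divide_distrib)
qed

lemma egf_power: "egf (\<lambda>n. c ^ n) = fps_exp c"
  by (rule fps_ext) (simp add: egf_nth)

lemma egf_inject: "egf f = egf g \<longleftrightarrow> f = g"
  by (auto simp: fps_eq_iff egf_nth)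

text \<open>This is the coefficient of \<open>X^n\<close> in \<open>(1 + X^2)^n\<close>, and its exponential generating function is the
  series \<open>\<Sum>j. X^(2 j) / (j!)^2\<close>.\<close>
definition mid_binomial :: "nat \<Rightarrow> nat" where
  "mid_binomial n = (if even n then n choose (n div 2) else 0)"

lemma fps_X_binomial_nth: "(1 + fps_X ^ d) ^ n $ k = (\<Sum>j\<le>n. if d * j = k then of_nat (n choose j) else (0::rat))"
proof -
  have "(1 + fps_X ^ d :: rat fps) ^ n = (\<Sum>j\<le>n. of_nat (n choose j) * fps_X ^ (d * j))"
    by (subst add.commute, subst binomial_ring) (simp add: power_mult)
  thus ?thesis
    by (auto simp add: fps_sum_nth simp flip: fps_of_nat intro!: sum.cong)
qed

text \<open>Both sides are the coefficient of \<open>X^k\<close> in \<open>(1 + X)^(2 k) = ((1 + X^2) + 2 X)^k\<close>.\<close>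
lemma central_binomial_eq:
  "of_nat ((2 * k) choose k) = (\<Sum>i\<le>k. of_nat (k choose i) * (of_nat (mid_binomial i) * 2 ^ (k - i) :: rat))"
proof -
  have mid: "(1 + fps_X ^ 2) ^ i $ i = (of_nat (mid_binomial i) :: rat)" for i
  proof (cases "even i")
    case True
    then obtain t where [simp]: "i = 2 * t" by blast
    show ?thesis unfolding fps_X_binomial_nth by (simp add: mid_binomial_def)
  next
    case False
    hence "2 * j \<noteq> i" for j by auto
    thus ?thesis using False by (simp add: mid_binomial_def fps_X_binomial_nth)
  qed
  have "((1 + fps_X) ^ (2 * k) :: rat fps) = (1 + fps_X ^ 2 + fps_const 2 * fps_X) ^ k"
  proof -
    have "fps_const 2 = (2 :: rat fps)" by (simp add: numeral_fps_const)
    hence "(1 + fps_X :: rat fps) ^ 2 = 1 + fps_X ^ 2 + fps_const 2 * fps_X"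
      by (simp add: power2_eq_square algebra_simps)
    thus ?thesis by (simp only: power_mult)
  qed
  also have "\<dots> = (\<Sum>i\<le>k. of_nat (k choose i) * (1 + fps_X ^ 2) ^ i * (fps_const 2 * fps_X) ^ (k - i))"
    by (rule binomial_ring)
  also have "\<dots> = (\<Sum>i\<le>k. fps_const (of_nat (k choose i) * 2 ^ (k - i)) * ((1 + fps_X ^ 2) ^ i * fps_X ^ (k - i)))"
    by (intro sum.cong refl) (simp only: power_mult_distrib fps_const_power fps_of_nat fps_const_mult[symmetric] mult_ac)
  finally have "((1 + fps_X) ^ (2 * k) :: rat fps) $ k = 
      (\<Sum>i\<le>k. of_nat (k choose i) * 2 ^ (k - i) * ((1 + fps_X ^ 2) ^ i $ i))"
    by (auto simp: fps_sum_nth fps_X_power_mult_right_nth intro!: sum.cong)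
  moreover have "((1 + fps_X) ^ (2 * k) :: rat fps) $ k = of_nat ((2 * k) choose k)"
    using fps_X_binomial_nth[of 1 "2 * k" k] by simp
  ultimately show ?thesis by (simp add: mid mult_ac)
qed

text \<open>For \<open>n = 2 t\<close> the nonzero summands have \<open>k = 2 s\<close> and equal \<open>(2 t choose t) * (t choose s)^2\<close>, and the sum
  over \<open>s\<close> of the squares is again \<open>2 t choose t\<close>.\<close>
lemma mid_binomial_convolution:
  "(\<Sum>k\<le>n. (n choose k) * mid_binomial k * mid_binomial (n - k)) = mid_binomial n ^ 2"
proof (cases "even n")
  case True
  then obtain t where n: "n = 2 * t" by blast
  have term_eq: "(2 * t choose 2 * s) * mid_binomial (2 * s) * mid_binomial (2 * t - 2 * s) =
      (2 * t choose t) * (t choose s) ^ 2" if "s \<le> t" for s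
  proof -
    have "2 * t - 2 * s = 2 * (t - s)" "2 * (t - s) + s - t = t - s" using that by auto
    hence "real ((2 * t choose 2 * s) * mid_binomial (2 * s) * mid_binomial (2 * t - 2 * s)) =
      real ((2 * t choose t) * (t choose s) ^ 2)"
      using that by (simp add: mid_binomial_def binomial_fact power2_eq_square)
    thus ?thesis by linarith
  qed
  have "(\<Sum>k\<le>n. (n choose k) * mid_binomial k * mid_binomial (n - k)) =
    (\<Sum>k\<in>(\<lambda>s. 2 * s) ` {..t}. (n choose k) * mid_binomial k * mid_binomial (n - k))"
    by (rule sum.mono_neutral_right) (auto simp: n mid_binomial_def elim!: evenE)
  also have "\<dots> = (\<Sum>s\<le>t. (2 * t choose t) * (t choose s) ^ 2)"
    by (subst sum.reindex) (auto simp: inj_on_def n term_eq intro!: sum.cong)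
  also have "\<dots> = mid_binomial n ^ 2"
    using choose_square_sum[of t]
    by (simp add: sum_distrib_left[symmetric] n mid_binomial_def power2_eq_square)
  finally show ?thesis .
next
  case False
  have "(n choose k) * mid_binomial k * mid_binomial (n - k) = 0" if "k \<le> n" for k
    using that False by (auto simp: mid_binomial_def)
  thus ?thesis using False by (simp add: mid_binomial_def)
qed

text \<open>\<open>central_binomial_eq\<close> factors an exponential out of the central binomial coefficients; squaring
  doubles its exponent and leaves the self-convolution of \<open>mid_binomial\<close>.\<close>
lemma egf_S: "egf (\<lambda>n. of_nat (S n)) = egf (\<lambda>n. of_nat (mid_binomial n ^ 2)) * fps_exp 4"
proof -
  let ?c = "egf (\<lambda>n. of_nat ((2 * n) choose n))"
  let ?e = "egf (\<lambda>n. of_nat (mid_binomial n))"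
  have "egf (\<lambda>n. of_nat (S n)) = ?c * ?c"
    by (simp add: egf_mult egf_inject S_def atLeast0AtMost diff_mult_distrib2)
  also have "?c = ?e * fps_exp 2"
    by (simp add: egf_mult egf_inject central_binomial_eq mult.assoc flip: egf_power)
  also have "\<dots> * \<dots> = (?e * ?e) * (fps_exp 2 * fps_exp 2)"
    by (simp only: mult_ac)
  also have "?e * ?e = egf (\<lambda>n. of_nat (mid_binomial n ^ 2))"
    by (simp add: egf_mult egf_inject flip: mid_binomial_convolution)
  also have "fps_exp 2 * fps_exp 2 = fps_exp (4 :: rat)"
    by (simp flip: fps_exp_add_mult)
  finally show ?thesis .
qed

text \<open>The inverse of the factor \<open>exp (4 X)\<close> of the generating function of \<open>S\<close> is \<open>exp (- 4 X)\<close>.\<close>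
lemma S_binomial_inversion:
  "(\<Sum>k\<le>n. int (n choose k) * int (S k) * (- 4) ^ (n - k)) = int (mid_binomial n) ^ 2"
proof -
  have "egf (\<lambda>n. of_nat (S n)) * fps_exp (- 4) =
      egf (\<lambda>n. of_nat (mid_binomial n ^ 2)) * (fps_exp 4 * fps_exp (- 4))"
    by (simp add: egf_S mult.assoc)
  also have "fps_exp 4 * fps_exp (- 4) = (1 :: rat fps)"
    by (simp flip: fps_exp_add_mult)
  finally have "(\<Sum>k\<le>n. of_nat (n choose k) * of_nat (S k) * (- 4) ^ (n - k)) = (of_nat (mid_binomial n ^ 2) :: rat)"
    by (simp add: egf_mult egf_inject fun_eq_iff flip: egf_power)
  hence "of_int (\<Sum>k\<le>n. int (n choose k) * int (S k) * (- 4) ^ (n - k)) =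
      (of_int (int (mid_binomial n) ^ 2) :: rat)"
    by simp
  thus ?thesis unfolding of_int_eq_iff .
qed


section \<open>The quadratic character modulo an odd prime\<close>

text \<open>Fixing the half \<open>m\<close> of \<open>p - 1\<close> as a parameter keeps divisions out of the exponents and binomial
  coefficients.\<close>
locale odd_prime =
  fixes p m :: nat
  assumes prime_p: "prime p" and p_eq: "p = 2 * m + 1"
begin

lemma odd_p: "odd p"
  using p_eq by simp

lemma int_p_eq: "int p = 2 * int m + 1"
  using p_eq by simp

lemma m_pos: "m > 0"
  using p_eq prime_gt_1_nat[OF prime_p] by simp

lemma p_gt_2: "p > 2"
  using p_eq m_pos by simp

lemma prime_int_p: "prime (int p)"
  using prime_p by simp

text \<open>Both sides satisfy the same first-order recurrence modulo \<open>p\<close>: the step from \<open>k\<close> to \<open>k + 1\<close>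
  multiplies by \<open>(4 k + 2) / (k + 1)\<close> on the left and by \<open>- 4 (m - k) / (k + 1)\<close> on the right, and the
  numerators differ by \<open>2 p\<close>. For \<open>k\<close> between \<open>m\<close> and \<open>p\<close> both sides vanish modulo \<open>p\<close>.\<close>
lemma central_binomial_cong:
  assumes "k < p"
  shows "[int ((2 * k) choose k) = (- 4) ^ k * int (m choose k)] (mod int p)"
  using assms
proof (induction k)
  case 0
  show ?case by simp
next
  case (Suc k)
  have "coprime (int (Suc k)) (int p)"
    using Suc.prems prime_imp_coprime[OF prime_p] nat_dvd_not_less[of "Suc k" p]
    by (simp only: coprime_int_iff coprime_commute[of "Suc k"]) blast
  moreover have "int (Suc k) * int (2 * Suc k choose Suc k) = (4 * int k + 2) * int (2 * k choose k)"
  proof -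
    have "Suc k * (2 * Suc k choose Suc k) = 2 * Suc k * (Suc (2 * k) choose k)"
      using Suc_times_binomial_eq[of "Suc (2 * k)" k] by (simp add: mult_ac)
    moreover have "Suc k * (Suc (2 * k) choose k) = Suc (2 * k) * (2 * k choose k)"
      using binomial_absorb_comp[of "Suc (2 * k)" k] by simp
    ultimately have "Suc k * (2 * Suc k choose Suc k) = (4 * k + 2) * (2 * k choose k)" 
      by (simp add: algebra_simps)
    thus ?thesis by (metis (mono_tags, lifting) of_nat_mult of_nat_add of_nat_numeral)
  qed
  moreover have "int (Suc k) * int (m choose Suc k) = (int m - int k) * int (m choose k)"
  proof (cases "k \<le> m")
    case True
    have "Suc k * (m choose Suc k) = (m - k) * (m choose k)"
      by (metis binomial_absorption binomial_absorb_comp)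
    hence "int (Suc k * (m choose Suc k)) = int ((m - k) * (m choose k))" by simp
    thus ?thesis using True by (simp only: of_nat_mult of_nat_diff)
  qed (simp add: binomial_eq_0)
  moreover have "[(4 * int k + 2) * int (2 * k choose k) = 
      - 4 * (int m - int k) * ((- 4) ^ k * int (m choose k))] (mod int p)"
  proof (rule cong_mult)
    have "4 * int k + 2 - (- 4 * (int m - int k)) = 2 * int p" using p_eq by simp
    thus "[4 * int k + 2 = - 4 * (int m - int k)] (mod int p)"
      by (metis cong_iff_dvd_diff dvd_triv_right)
    show "[int (2 * k choose k) = (- 4) ^ k * int (m choose k)] (mod int p)"
      using Suc by simp
  qed
  moreover have "- 4 * (int m - int k) * ((- 4) ^ k * int (m choose k)) =
      (- 4) ^ Suc k * ((int m - int k) * int (m choose k))"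
    by (simp only: power_Suc mult_ac)
  ultimately have "[int (Suc k) * int (2 * Suc k choose Suc k) = 
     (- 4) ^ Suc k * (int (Suc k) * int (m choose Suc k))] (mod int p)"
    by (simp only:)
  hence "[int (Suc k) * int (2 * Suc k choose Suc k) = 
     int (Suc k) * ((- 4) ^ Suc k * int (m choose Suc k))] (mod int p)"
    by (simp only: mult_ac)
  thus ?case using \<open>coprime (int (Suc k)) (int p)\<close>
    by (simp only: cong_mult_lcancel)
qed

lemma coprime_p_iff: "coprime a (int p) \<longleftrightarrow> \<not> int p dvd a"
  using prime_int_p
  by (metis coprime_commute not_coprimeI[of "int p" "int p" a] dvd_refl not_prime_unit prime_imp_coprime)

definition chi :: "int \<Rightarrow> int" where "chi a = Legendre a (int p)"

lemma chi_cases: "chi a = 0 \<or> chi a = 1 \<or> chi a = - 1"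
  by (simp add: chi_def Legendre_def)

lemma chi_euler: "[chi a = a ^ m] (mod int p)"
proof -
  have "(p - 1) div 2 = m" using p_eq by simp
  thus ?thesis using euler_criterion[OF prime_p p_gt_2, of a] by (simp add: chi_def)
qed

text \<open>The difference is smaller than \<open>p\<close> in absolute value. Identities for the character can thus be read off from congruences for \<open>m\<close>-th powers.\<close>
lemma sign_cong_imp_eq:
  assumes "[u = v] (mod int p)" "\<bar>u\<bar> \<le> 1" "\<bar>v\<bar> \<le> 1"
  shows "u = v"
proof -
  have "int p dvd u - v" using assms(1) by (simp add: cong_iff_dvd_diff)
  moreover have "\<bar>u - v\<bar> < int p" using assms(2,3) p_gt_2 by linarith
  ultimately show ?thesis using zdvd_not_zless[of "\<bar>u - v\<bar>" "int p"] by fastforce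
qed

lemma abs_chi: "\<bar>chi a\<bar> \<le> 1"
  using chi_cases[of a] by auto

lemma chi_cong: "[a = b] (mod int p) \<Longrightarrow> chi a = chi b"
  by (rule sign_cong_imp_eq[OF _ abs_chi abs_chi])
     (meson chi_euler cong_pow cong_sym cong_trans)

lemma chi_mult: "chi (a * b) = chi a * chi b"
proof (rule sign_cong_imp_eq[OF _ abs_chi])
  have "[chi a * chi b = a ^ m * b ^ m] (mod int p)"
    by (intro cong_mult chi_euler)
  thus "[chi (a * b) = chi a * chi b] (mod int p)"
    using chi_euler[of "a * b"] by (metis cong_sym cong_trans power_mult_distrib)
  show "\<bar>chi a * chi b\<bar> \<le> 1"
    using chi_cases[of a] chi_cases[of b] by auto
qed

lemma chi_eq_0_iff: "chi a = 0 \<longleftrightarrow> int p dvd a"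
  by (auto simp: chi_def Legendre_def cong_0_iff)

lemma chi_square: "chi a * chi a = (if int p dvd a then 0 else 1)"
  using chi_cases[of a] by (auto simp: chi_eq_0_iff)

lemma chi_eq_1E:
  assumes "chi a = 1" obtains y where "[y ^ 2 = a] (mod int p)" "\<not> int p dvd y"
proof -
  obtain y where y: "[y ^ 2 = a] (mod int p)"
    using assms by (auto simp: chi_def Legendre_def QuadRes_def split: if_splits)
  have "\<not> int p dvd y"
  proof
    assume "int p dvd y"
    hence "int p dvd y ^ 2" by (simp add: power2_eq_square)
    hence "chi (y ^ 2) = 0" using chi_eq_0_iff by simp
    thus False using chi_cong[OF y] assms by simp
  qed
  thus ?thesis using that y by blast
qed

lemma chi_minus_1: "even m \<Longrightarrow> chi (- 1) = 1"
  using sign_cong_imp_eq[OF chi_euler abs_chi, of "- 1"] by simp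

lemma primitive_rootE:
  obtains g :: int where "\<not> int p dvd g"
    "\<And>k. [g ^ k = 1] (mod int p) \<longleftrightarrow> p - 1 dvd k"
proof -
  obtain g where g: "residue_primroot p g"
    using prime_primitive_root_exists[of p] prime_p prime_gt_1_nat by blast
  have "[int g ^ k = 1] (mod int p) \<longleftrightarrow> p - 1 dvd k" for k
  proof -
    have "[int g ^ k = 1] (mod int p) \<longleftrightarrow> [g ^ k = 1] (mod p)"
      by (metis cong_int_iff of_nat_1 of_nat_power)
    thus ?thesis using g prime_p
      by (simp add: ord_divides ord_divides' residue_primroot_def totient_prime)
  qed
  moreover have "\<not> int p dvd int g"
    using g coprime_p_iff[of "int g"] by (simp add: residue_primroot_def coprime_commute)
  ultimately show ?thesis using that by blast
qed

lemma nonresidueE: obtains n where "chi n = - 1"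
proof -
  obtain g where g: "\<not> int p dvd g" "\<And>k. [g ^ k = 1] (mod int p) \<longleftrightarrow> p - 1 dvd k"
    using primitive_rootE by blast
  have "\<not> p - 1 dvd m" using p_eq m_pos by (auto dest: dvd_imp_le)
  hence "\<not> [g ^ m = 1] (mod int p)" using g(2) by simp
  hence "chi g \<noteq> 1" using chi_euler[of g] by (metis cong_sym)
  thus ?thesis using that g(1) chi_cases[of g] chi_eq_0_iff[of g] by blast
qed

section \<open>Sums over a complete residue system\<close>

definition residue_reps :: "int set" where "residue_reps = {0..<int p}"

lemma finite_residue_reps [simp]: "finite residue_reps"
  by (simp add: residue_reps_def)

lemma residue_reps_eq: "residue_reps = insert 0 {1..<int p}"
  using p_gt_2 by (auto simp: residue_reps_def)

lemma not_dvd_residue: "x \<in> {1..<int p} \<Longrightarrow> \<not> int p dvd x"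
  using zdvd_not_zless by fastforce

text \<open>The substitution \<open>x \<mapsto> k x + c\<close> permutes the residue classes; this gives the behaviour of the character
  sums below under scaling and translation.\<close>
lemma sum_affine_shift:
  assumes per: "\<And>x y. [x = y] (mod int p) \<Longrightarrow> f x = f y" and k: "\<not> int p dvd k"
  shows "(\<Sum>x\<in>residue_reps. f (k * x + c)) = sum f residue_reps"
proof -
  let ?h = "\<lambda>x. (k * x + c) mod int p"
  have "inj_on ?h residue_reps"
  proof (rule inj_onI)
    fix x y assume xy: "x \<in> residue_reps" "y \<in> residue_reps" "?h x = ?h y"
    hence "[k * x + c = k * y + c] (mod int p)" by (simp add: cong_def)
    hence "[k * x = k * y] (mod int p)" by (rule cong_add_rcancel[THEN iffD1])
    hence "[x = y] (mod int p)" using k coprime_p_iff by (simp add: cong_mult_lcancel)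
    thus "x = y" using xy(1,2) by (simp add: residue_reps_def cong_def)
  qed
  moreover have "?h ` residue_reps \<subseteq> residue_reps" using p_gt_2 by (auto simp: residue_reps_def)
  ultimately have "bij_betw ?h residue_reps residue_reps"
    by (simp add: bij_betw_def endo_inj_surj)
  hence "(\<Sum>x\<in>residue_reps. f (?h x)) = sum f residue_reps"
    by (rule sum.reindex_bij_betw)
  moreover have "f (?h x) = f (k * x + c)" for x by (rule per) simp
  ultimately show ?thesis by simp
qed

text \<open>If \<open>p - 1\<close> does not divide \<open>k\<close>, scaling by a primitive root \<open>g\<close> multiplies the sum by \<open>g^k\<close>, which is
  not \<open>1\<close> modulo \<open>p\<close>, so the sum vanishes. Otherwise Fermat's theorem makes each of the \<open>p - 1\<close> nonzero
  terms \<open>1\<close>. For \<open>k = 0\<close> the term at \<open>x = 0\<close> would contribute as well.\<close>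
lemma sum_powers_cong:
  assumes "k > 0"
  shows "[(\<Sum>x\<in>residue_reps. x ^ k) = (if p - 1 dvd k then - 1 else 0)] (mod int p)"
proof (cases "p - 1 dvd k")
  case True
  then obtain d where d: "k = (p - 1) * d" by blast
  have "[x ^ k = 1] (mod int p)" if "x \<in> {1..<int p}" for x
  proof -
    have "[nat x ^ (p - 1) = 1] (mod p)"
      using not_dvd_residue[OF that] that prime_p by (intro fermat_theorem) (auto simp flip: int_dvd_int_iff)
    hence "[int (nat x ^ (p - 1)) = int 1] (mod int p)" unfolding cong_int_iff .
    hence "[x ^ (p - 1) = 1] (mod int p)" using that by simp
    from cong_pow[OF this, of d] show ?thesis by (simp add: d power_mult)
  qed
  hence "[(\<Sum>x\<in>{1..<int p}. x ^ k) = (\<Sum>x\<in>{1..<int p}. 1)] (mod int p)"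
    by (rule cong_sum)
  also have "(\<Sum>x\<in>{1..<int p}. 1) = int p + - 1" using p_gt_2 by simp
  also have "[\<dots> = - 1] (mod int p)" by (simp add: cong_def)
  finally show ?thesis using True assms by (simp add: residue_reps_eq zero_power)
next
  case False
  obtain g where g: "\<not> int p dvd g" "\<And>k. [g ^ k = 1] (mod int p) \<longleftrightarrow> p - 1 dvd k"
    using primitive_rootE by blast
  let ?s = "\<Sum>x\<in>residue_reps. x ^ k"
  have "(\<Sum>x\<in>residue_reps. (g * x + 0) ^ k mod int p) = (\<Sum>x\<in>residue_reps. x ^ k mod int p)"
    by (rule sum_affine_shift[OF _ g(1)]) (use cong_pow in \<open>auto simp: cong_def\<close>)
  hence "[(\<Sum>x\<in>residue_reps. (g * x + 0) ^ k) = ?s] (mod int p)"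
    unfolding cong_def by (subst (1 2) mod_sum_eq[symmetric]) (simp only:)
  moreover have "(\<Sum>x\<in>residue_reps. (g * x + 0) ^ k) = g ^ k * ?s"
    by (simp add: power_mult_distrib sum_distrib_left)
  ultimately have "int p dvd (g ^ k - 1) * ?s"
    by (simp only: cong_iff_dvd_diff left_diff_distrib mult_1_left)
  moreover have "\<not> int p dvd g ^ k - 1"
    using g(2)[of k] False by (simp add: cong_iff_dvd_diff)
  ultimately have "int p dvd ?s" using prime_int_p prime_dvd_mult_iff by blast
  thus ?thesis using False by (simp add: cong_0_iff)
qed

lemma sum_chi: "(\<Sum>x\<in>residue_reps. chi x) = 0"
proof -
  obtain n where n: "chi n = - 1" using nonresidueE by blast
  hence "\<not> int p dvd n" using n chi_eq_0_iff[of n] by simp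
  from sum_affine_shift[of chi n 0, OF chi_cong this] show ?thesis
    by (simp add: chi_mult n sum_negf)
qed

lemma sum_chi_square: "(\<Sum>x\<in>residue_reps. chi x * chi x) = int p - 1"
proof -
  have "(\<Sum>x\<in>{1..<int p}. chi x * chi x) = (\<Sum>x\<in>{1..<int p}. 1)"
    by (intro sum.cong refl) (simp add: chi_square not_dvd_residue)
  thus ?thesis using p_gt_2 by (simp add: residue_reps_eq chi_square[of 0])
qed

text \<open>Translation reduces the sum to \<open>D d = \<Sum>b. \<chi> b * \<chi> (b + d)\<close> with \<open>d = v - u\<close>. Scaling \<open>b\<close> by \<open>d\<close> shows that
  \<open>D\<close> is constant on nonzero \<open>d\<close>; as \<open>D 0 = p - 1\<close> and all values of \<open>D\<close> add up to \<open>0\<close>, the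
  constant is \<open>- 1\<close>.\<close>
lemma sum_chi_chi:
  "(\<Sum>a\<in>residue_reps. chi (u + a) * chi (v + a)) = (if [u = v] (mod int p) then int p - 1 else - 1)"
proof -
  define D where "D d = (\<Sum>b\<in>residue_reps. chi b * chi (b + d))" for d
  have D_cong: "D d = D e" if "[d = e] (mod int p)" for d e
    unfolding D_def by (intro sum.cong refl arg_cong2[where f = "(*)"] chi_cong cong_add that cong_refl)
  have per: "chi x * chi (x + d) = chi y * chi (y + d)" if "[x = y] (mod int p)" for x y d
    by (intro arg_cong2[where f = "(*)"] chi_cong cong_add that cong_refl)
  have D0: "D 0 = int p - 1" by (simp add: D_def sum_chi_square)
  have scale: "D d = D 1" if "\<not> int p dvd d" for d
  proof -
    have "D d = (\<Sum>b\<in>residue_reps. chi (d * b + 0) * chi (d * b + 0 + d))"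
      unfolding D_def by (rule sum_affine_shift[OF per that, symmetric])
    also have "\<dots> = (\<Sum>b\<in>residue_reps. (chi d * chi d) * (chi b * chi (b + 1)))"
    proof (intro sum.cong refl)
      fix b
      have "d * b + 0 + d = d * (b + 1)" by (simp add: algebra_simps)
      thus "chi (d * b + 0) * chi (d * b + 0 + d) = (chi d * chi d) * (chi b * chi (b + 1))"
        by (simp add: chi_mult)
    qed
    also have "\<dots> = D 1" using that by (simp add: D_def chi_square)
    finally show ?thesis .
  qed
  have "(\<Sum>d\<in>residue_reps. D d) = (\<Sum>b\<in>residue_reps. chi b * (\<Sum>d\<in>residue_reps. chi (1 * d + b)))"
    unfolding D_def by (subst sum.swap) (simp add: sum_distrib_left add.commute)
  also have "\<dots> = 0"
    using sum_affine_shift[of chi 1, OF chi_cong] p_gt_2 by (simp add: sum_chi)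
  finally have "D 0 + (\<Sum>d\<in>{1..<int p}. D d) = 0" by (simp add: residue_reps_eq)
  moreover have "(\<Sum>d\<in>{1..<int p}. D d) = (\<Sum>d\<in>{1..<int p}. D 1)"
    by (intro sum.cong refl scale not_dvd_residue)
  ultimately have "(int p - 1) * (D 1 + 1) = 0"
    using D0 p_gt_2 by (simp add: algebra_simps)
  hence D1: "D 1 = - 1" using p_gt_2 by auto
  have "(\<Sum>a\<in>residue_reps. chi (1 * a + u) * chi (1 * a + u + (v - u))) = D (v - u)"
    unfolding D_def using p_gt_2 by (intro sum_affine_shift per) auto
  hence "(\<Sum>a\<in>residue_reps. chi (u + a) * chi (v + a)) = D (v - u)"
    by (simp add: algebra_simps)
  also have "\<dots> = (if [u = v] (mod int p) then int p - 1 else - 1)"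
  proof (cases "[u = v] (mod int p)")
    case True
    hence "[v - u = 0] (mod int p)" by (simp add: cong_iff_dvd_diff dvd_diff_commute)
    thus ?thesis using D_cong D0 True by metis
  next
    case False
    hence "\<not> int p dvd v - u" by (simp add: cong_iff_dvd_diff dvd_diff_commute)
    thus ?thesis using scale D1 False by simp
  qed
  finally show ?thesis .
qed

section \<open>Jacobsthal sums\<close>

definition jacobsthal :: "int \<Rightarrow> int" where
  "jacobsthal a = (\<Sum>x\<in>residue_reps. chi x * chi (x ^ 2 + a))"

lemma jacobsthal_summand_cong:
  assumes "[x = y] (mod int p)" "[a = b] (mod int p)"
  shows "chi x * chi (x ^ 2 + a) = chi y * chi (y ^ 2 + b)"
  by (intro arg_cong2[where f = "(*)"] chi_cong cong_add cong_pow assms)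

lemma jacobsthal_cong: "[a = b] (mod int p) \<Longrightarrow> jacobsthal a = jacobsthal b"
  unfolding jacobsthal_def by (intro sum.cong refl jacobsthal_summand_cong cong_refl)

lemma jacobsthal_scale:
  assumes "\<not> int p dvd k" shows "jacobsthal (a * k ^ 2) = chi k * jacobsthal a"
proof -
  have "jacobsthal (a * k ^ 2) = (\<Sum>x\<in>residue_reps. chi (k * x + 0) * chi ((k * x + 0) ^ 2 + a * k ^ 2))"
    unfolding jacobsthal_def
    by (rule sum_affine_shift[OF jacobsthal_summand_cong assms, symmetric]) auto
  also have "\<dots> = (\<Sum>x\<in>residue_reps. chi k * (chi x * chi (x ^ 2 + a)))"
  proof (intro sum.cong refl)
    fix x
    have "(k * x + 0) ^ 2 + a * k ^ 2 = k * (k * (x ^ 2 + a))"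
      by (simp add: algebra_simps power2_eq_square)
    thus "chi (k * x + 0) * chi ((k * x + 0) ^ 2 + a * k ^ 2) = chi k * (chi x * chi (x ^ 2 + a))"
      using assms chi_square[of k] by (simp add: chi_mult)
  qed
  finally show ?thesis by (simp add: jacobsthal_def sum_distrib_left)
qed

lemma jacobsthal_0: "jacobsthal 0 = 0"
proof -
  have "chi x * (chi x * chi x) = chi x" for x
    using chi_cases[of x] by auto
  hence "chi x * chi (x ^ 2 + 0) = chi x" for x by (simp only: power2_eq_square chi_mult add_0_right)
  hence "jacobsthal 0 = (\<Sum>x\<in>residue_reps. chi x)" by (simp only: jacobsthal_def)
  thus ?thesis using sum_chi by simp
qed

text \<open>Only \<open>y = x\<close> and \<open>y = - x\<close> contribute, each with \<open>1\<close> because \<open>\<chi> (- 1) = 1\<close> for even \<open>m\<close>.\<close>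
lemma sum_chi_same_square:
  assumes "even m" "x \<in> {1..<int p}"
  shows "(\<Sum>y\<in>residue_reps. chi x * chi y * (if [x ^ 2 = y ^ 2] (mod int p) then 1 else 0)) = 2"
proof -
  have x0: "\<not> int p dvd x" by (rule not_dvd_residue[OF assms(2)])
  have iff: "[x ^ 2 = y ^ 2] (mod int p) \<longleftrightarrow> y = x \<or> y = int p - x" if "y \<in> residue_reps" for y
  proof -
    have "x ^ 2 - y ^ 2 = (x - y) * (x + y)" by (simp add: algebra_simps power2_eq_square)
    hence "[x ^ 2 = y ^ 2] (mod int p) \<longleftrightarrow> int p dvd x - y \<or> int p dvd x + y"
      using prime_dvd_mult_iff[OF prime_int_p] by (simp add: cong_iff_dvd_diff)
    also have "int p dvd x - y \<longleftrightarrow> x mod int p = y mod int p" by (simp add: mod_eq_dvd_iff)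
    also have "\<dots> \<longleftrightarrow> y = x" using assms(2) that by (auto simp: residue_reps_def)
    also have "int p dvd x + y \<longleftrightarrow> y = int p - x"
    proof
      assume "int p dvd x + y"
      then obtain q where q: "x + y = int p * q" by blast
      have "0 < x + y" "x + y < int p * 2" using assms(2) that by (auto simp: residue_reps_def)
      hence "0 < q" "q < 2" using q p_gt_2 by (auto simp: zero_less_mult_iff)
      hence "q = 1" by simp
      thus "y = int p - x" using q by simp
    qed simp
    finally show ?thesis .
  qed
  have neq: "x \<noteq> int p - x" using p_eq by presburger
  have "chi (int p - x) = chi (- 1 * x)" by (rule chi_cong) (simp add: cong_iff_dvd_diff)
  hence chi_neg: "chi (int p - x) = chi x" using chi_minus_1[OF assms(1)] by (simp only: chi_mult)
  have "(\<Sum>y\<in>residue_reps. chi x * chi y * (if [x ^ 2 = y ^ 2] (mod int p) then 1 else 0)) =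
      (\<Sum>y\<in>{x, int p - x}. chi x * chi y)"
    using assms(2) iff by (intro sum.mono_neutral_cong_right) (auto simp: residue_reps_def)
  also have "\<dots> = 2" using neq chi_neg chi_square[of x] x0 by simp
  finally show ?thesis .
qed

text \<open>Expanding the square and summing over \<open>a\<close> first, \<open>sum_chi_chi\<close> leaves \<open>p\<close> times the sum over pairs with
  \<open>x^2 = y^2\<close>, minus the product of two vanishing character sums.\<close>
lemma sum_jacobsthal_square:
  assumes "even m"
  shows "(\<Sum>a\<in>residue_reps. jacobsthal a ^ 2) = 2 * int p * (int p - 1)"
proof -
  let ?i = "\<lambda>x y. if [x ^ 2 = y ^ 2] (mod int p) then 1 else 0 :: int"
  have "(\<Sum>a\<in>residue_reps. jacobsthal a ^ 2) = (\<Sum>a\<in>residue_reps. \<Sum>x\<in>residue_reps. \<Sum>y\<in>residue_reps.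
      chi x * chi y * (chi (x ^ 2 + a) * chi (y ^ 2 + a)))"
    by (simp add: jacobsthal_def power2_eq_square[of "sum _ _"] sum_product mult_ac)
  also have "\<dots> = (\<Sum>x\<in>residue_reps. \<Sum>y\<in>residue_reps. \<Sum>a\<in>residue_reps.
      chi x * chi y * (chi (x ^ 2 + a) * chi (y ^ 2 + a)))"
    by (subst sum.swap) (intro sum.cong refl sum.swap)
  also have "\<dots> = (\<Sum>x\<in>residue_reps. \<Sum>y\<in>residue_reps. chi x * chi y * (int p * ?i x y - 1))"
    by (intro sum.cong refl) (simp add: sum_chi_chi flip: sum_distrib_left)
  also have "\<dots> = int p * (\<Sum>x\<in>residue_reps. \<Sum>y\<in>residue_reps. chi x * chi y * ?i x y) -
      (\<Sum>x\<in>residue_reps. chi x) * (\<Sum>y\<in>residue_reps. chi y)"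
    by (simp only: sum_product sum_distrib_left sum_subtractf right_diff_distrib mult_ac mult_1_left mult_1_right)
  also have "(\<Sum>x\<in>residue_reps. \<Sum>y\<in>residue_reps. chi x * chi y * ?i x y) = 2 * (int p - 1)"
  proof -
    have "(\<Sum>x\<in>{1..<int p}. \<Sum>y\<in>residue_reps. chi x * chi y * ?i x y) = (\<Sum>x\<in>{1..<int p}. 2)"
      by (intro sum.cong refl sum_chi_same_square assms)
    moreover have "chi 0 = 0" by (simp add: chi_eq_0_iff)
    moreover have "(\<Sum>x\<in>residue_reps. G x) = G 0 + (\<Sum>x\<in>{1..<int p}. G x)" for G :: "int \<Rightarrow> int"
      by (simp add: residue_reps_eq)
    ultimately show ?thesis using p_gt_2 by simp
  qed
  finally show ?thesis by (simp add: sum_chi)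
qed

text \<open>Among nonzero \<open>a\<close>, half are squares times \<open>1\<close> and half are squares times \<open>n\<close>, so the second moment
  equals \<open>m\<close> times the left-hand side.\<close>
lemma jacobsthal_sum_two_squares:
  assumes "even m" "chi n = - 1"
  shows "jacobsthal 1 ^ 2 + jacobsthal n ^ 2 = 4 * int p"
proof -
  have sq1: "jacobsthal (c * y ^ 2) ^ 2 = jacobsthal c ^ 2" if "\<not> int p dvd y" for c y
    unfolding jacobsthal_scale[OF that] using that chi_square[of y]
    by (simp add: power_mult_distrib power2_eq_square)
  have n0: "\<not> int p dvd n" using assms(2) chi_eq_0_iff[of n] by auto
  \<comment> \<open>The two coefficients are twice the indicators of residues and of nonresidues, written so that they can be summed.\<close>
  have val: "2 * jacobsthal a ^ 2 = (chi a * chi a + chi a) * jacobsthal 1 ^ 2 + (chi a * chi a - chi a) * jacobsthal n ^ 2" for a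
  proof -
    consider "chi a = 0" | "chi a = 1" | "chi a = - 1" using chi_cases by blast
    thus ?thesis
    proof cases
      case 1
      hence "[a = 0] (mod int p)" by (simp add: chi_eq_0_iff cong_0_iff)
      thus ?thesis using 1 jacobsthal_0 jacobsthal_cong[of a 0] by simp
    next
      case 2
      then obtain y where y: "[y ^ 2 = a] (mod int p)" "\<not> int p dvd y" using chi_eq_1E by blast
      thus ?thesis using 2 sq1[OF y(2), of 1] jacobsthal_cong[OF y(1)] by simp
    next
      case 3
      hence "chi (a * n) = 1" by (simp add: chi_mult assms(2))
      then obtain y where y: "[y ^ 2 = a * n] (mod int p)" "\<not> int p dvd y" using chi_eq_1E by blast
      have "[n * y ^ 2 = a * n ^ 2] (mod int p)"
        using cong_scalar_left[OF y(1), of n] by (simp add: power2_eq_square mult_ac)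
      hence "jacobsthal (n * y ^ 2) = jacobsthal (a * n ^ 2)" by (rule jacobsthal_cong)
      hence "jacobsthal a ^ 2 = jacobsthal n ^ 2" using sq1[OF n0, of a] sq1[OF y(2), of n] by simp
      thus ?thesis using 3 by simp
    qed
  qed
  have "2 * (\<Sum>a\<in>residue_reps. jacobsthal a ^ 2) =
      ((\<Sum>a\<in>residue_reps. chi a * chi a) + (\<Sum>a\<in>residue_reps. chi a)) * jacobsthal 1 ^ 2 +
      ((\<Sum>a\<in>residue_reps. chi a * chi a) - (\<Sum>a\<in>residue_reps. chi a)) * jacobsthal n ^ 2"
    by (simp only: sum_distrib_left val sum.distrib sum_distrib_right sum_subtractf distrib_right left_diff_distrib)
  hence "(int p - 1) * (jacobsthal 1 ^ 2 + jacobsthal n ^ 2) = (int p - 1) * (4 * int p)"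
    by (simp add: sum_jacobsthal_square[OF assms(1)] sum_chi sum_chi_square algebra_simps)
  thus ?thesis using p_gt_2 by simp
qed

text \<open>The summand is even in \<open>x\<close> because \<open>\<chi> (- 1) = 1\<close>.\<close>
lemma jacobsthal_eq_double:
  assumes "even m"
  shows "jacobsthal a = 2 * (\<Sum>x\<in>{1..int m}. chi x * chi (x ^ 2 + a))"
proof -
  let ?f = "\<lambda>x. chi x * chi (x ^ 2 + a)"
  have reflect: "?f (int p - x) = ?f x" for x
  proof -
    have "[int p - x = - x] (mod int p)" by (simp add: cong_iff_dvd_diff)
    from jacobsthal_summand_cong[OF this cong_refl, of a]
    have "?f (int p - x) = ?f (- x)" .
    moreover have "chi (- x) = chi x" using chi_mult[of "- 1" x] chi_minus_1[OF assms] by simp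
    ultimately show ?thesis by simp
  qed
  have R: "residue_reps = insert 0 ({1..int m} \<union> {int m + 1..2 * int m})"
    unfolding residue_reps_def int_p_eq by auto
  have "jacobsthal a = sum ?f {1..int m} + sum ?f {int m + 1..2 * int m}"
    unfolding jacobsthal_def R by (subst sum.insert) (auto simp: sum.union_disjoint chi_eq_0_iff)
  also have "sum ?f {int m + 1..2 * int m} = sum ?f {1..int m}"
    by (rule sum.reindex_bij_witness[where i = "\<lambda>x. int p - x" and j = "\<lambda>x. int p - x"])
       (auto simp: int_p_eq reflect[unfolded int_p_eq])
  finally show ?thesis by simp
qed

text \<open>A summand is \<open>1\<close> or \<open>- 1\<close>, hence odd, unless \<open>x^2 = - 1\<close> modulo \<open>p\<close>; this happens for exactly one \<open>x\<close> in
  the lower half system, so there are \<open>m - 1\<close> odd summands.\<close>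
lemma odd_half_jacobsthal_1:
  assumes "even m"
  shows "odd (\<Sum>x\<in>{1..int m}. chi x * chi (x ^ 2 + 1))"
proof -
  obtain y where y: "[y ^ 2 = - 1] (mod int p)"
    using chi_eq_1E[OF chi_minus_1[OF assms]] by blast
  obtain i where i: "i \<in> {1..int m}" "[i ^ 2 = - 1] (mod int p)"
  proof (cases "y mod int p \<le> int m")
    case True
    have sq: "[(y mod int p) ^ 2 = - 1] (mod int p)"
      using y by (metis cong_def power_mod)
    have "y mod int p \<noteq> 0"
    proof
      assume "y mod int p = 0"
      hence "int p dvd 1" using sq by (simp add: cong_iff_dvd_diff)
      thus False using p_gt_2 by simp
    qed
    moreover have "y mod int p \<ge> 0" using p_gt_2 by simp
    ultimately show ?thesis using that[OF _ sq] True by simp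
  next
    case False
    have "[int p - y mod int p = - y] (mod int p)"
    proof -
      have "int p - y mod int p - (- y) = int p + (y - y mod int p)" by simp
      thus ?thesis by (simp only: cong_iff_dvd_diff dvd_add dvd_refl dvd_minus_mod)
    qed
    hence "[(int p - y mod int p) ^ 2 = (- y) ^ 2] (mod int p)" by (rule cong_pow)
    hence "[(int p - y mod int p) ^ 2 = - 1] (mod int p)" using y cong_trans by fastforce
    moreover have "int p - y mod int p \<in> {1..int m}"
      using False int_p_eq pos_mod_bound[of "int p" y] p_gt_2 by simp
    ultimately show ?thesis using that by blast
  qed
  have root: "int p dvd x ^ 2 + 1 \<longleftrightarrow> x = i" if "x \<in> {1..int m}" for x
  proof
    assume "int p dvd x ^ 2 + 1"
    moreover have "int p dvd i ^ 2 + 1" using i(2) by (simp add: cong_iff_dvd_diff)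
    ultimately have "int p dvd (x ^ 2 + 1) - (i ^ 2 + 1)" by (rule dvd_diff)
    also have "(x ^ 2 + 1) - (i ^ 2 + 1) = (x - i) * (x + i)" by (simp add: algebra_simps power2_eq_square)
    finally have "int p dvd x - i \<or> int p dvd x + i"
      using prime_dvd_mult_iff[OF prime_int_p] by blast
    moreover have "\<not> int p dvd x + i" using that i(1) p_eq by (intro not_dvd_residue) auto
    ultimately have "int p dvd \<bar>x - i\<bar>" by simp
    moreover have "\<bar>x - i\<bar> < int p" using that i(1) p_eq by auto
    ultimately show "x = i" using zdvd_not_zless[of "\<bar>x - i\<bar>" "int p"] by fastforce
  qed (use i(2) in \<open>simp add: cong_iff_dvd_diff\<close>)
  have "odd (chi x * chi (x ^ 2 + 1)) \<longleftrightarrow> x \<noteq> i" if "x \<in> {1..int m}" for x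
  proof -
    have "odd (chi c) \<longleftrightarrow> \<not> int p dvd c" for c
      using chi_cases[of c] chi_eq_0_iff[of c] by auto
    moreover have "\<not> int p dvd x" using that p_eq by (intro not_dvd_residue) auto
    ultimately show ?thesis using root[OF that] by simp
  qed
  hence "{x \<in> {1..int m}. odd (chi x * chi (x ^ 2 + 1))} = {1..int m} - {i}"
    by (auto simp del: even_mult_iff)
  hence "card {x \<in> {1..int m}. odd (chi x * chi (x ^ 2 + 1))} = m - 1"
    using i(1) by (simp add: card_Diff_singleton)
  thus ?thesis using assms m_pos by (subst even_sum_iff) auto
qed

text \<open>By Euler's criterion the sum is congruent to \<open>\<Sum>x. x^m * (x^2 + 1)^m\<close>. Its exponents \<open>m + 2 j\<close> lie between
  \<open>m\<close> and \<open>3 m\<close>, and the only multiple of \<open>p - 1 = 2 m\<close> in this range is \<open>2 m\<close>, reached at \<open>j = m / 2\<close>.\<close>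
lemma jacobsthal_1_cong:
  assumes "even m"
  shows "[jacobsthal 1 = - int (m choose (m div 2))] (mod int p)"
proof -
  have "[jacobsthal 1 = (\<Sum>x\<in>residue_reps. x ^ m * (x ^ 2 + 1) ^ m)] (mod int p)"
    unfolding jacobsthal_def by (intro cong_sum cong_mult chi_euler)
  also have "(\<Sum>x\<in>residue_reps. x ^ m * (x ^ 2 + 1) ^ m) =
      (\<Sum>x\<in>residue_reps. \<Sum>j\<le>m. int (m choose j) * x ^ (m + 2 * j))"
    unfolding binomial_ring sum_distrib_left
    by (intro sum.cong refl) (simp add: power_add power_mult mult.left_commute)
  also have "\<dots> = (\<Sum>j\<le>m. int (m choose j) * (\<Sum>x\<in>residue_reps. x ^ (m + 2 * j)))"
    by (subst sum.swap) (simp add: sum_distrib_left)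
  also have "[\<dots> = (\<Sum>j\<le>m. int (m choose j) * (if j = m div 2 then - 1 else 0))] (mod int p)"
  proof (intro cong_sum cong_mult cong_refl)
    fix j assume j: "j \<in> {..m}"
    have "p - 1 dvd m + 2 * j \<longleftrightarrow> j = m div 2"
    proof
      assume "p - 1 dvd m + 2 * j"
      then obtain q where q: "m + 2 * j = 2 * m * q" using p_eq by auto
      have "q = 1"
      proof -
        have "q \<noteq> 0"
        proof
          assume "q = 0"
          thus False using q m_pos by simp
        qed
        moreover have "q < 2"
        proof (rule ccontr)
          assume "\<not> q < 2"
          hence "2 * m * 2 \<le> 2 * m * q" by (intro mult_le_mono) auto
          \<comment> \<open>A multiple of \<open>2 m\<close> beyond \<open>2 m\<close> itself would be at least \<open>4 m\<close>, but the exponent is at most \<open>3 m\<close>.\<close>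
          hence "2 * m * 2 \<le> m + 2 * j" by (simp only: q)
          thus False using j m_pos by simp
        qed
        ultimately show ?thesis by simp
      qed
      thus "j = m div 2" using q by simp
    qed (use assms p_eq in auto)
    thus "[(\<Sum>x\<in>residue_reps. x ^ (m + 2 * j)) = (if j = m div 2 then - 1 else 0)] (mod int p)"
      using sum_powers_cong[of "m + 2 * j"] m_pos by simp
  qed
  also have "(\<Sum>j\<le>m. int (m choose j) * (if j = m div 2 then - 1 else 0)) = - int (m choose (m div 2))"
    by (simp add: if_distrib[of "\<lambda>z. _ * z"] cong: if_cong)
  finally show ?thesis .
qed

end

section \<open>Uniqueness of the representation as a sum of two squares\<close>

text \<open>In \<open>q^2 = (x a + y b)^2 + (x b - y a)^2\<close> the second square is a multiple of \<open>q^2\<close>, and the first is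
  nonzero because \<open>x a + y b\<close> is odd. Hence \<open>x b = y a\<close>, and the two representations are proportional.\<close>
lemma sum_two_squares_unique_aux:
  fixes a b x y :: int
  assumes "prime q" "odd q" "q = a ^ 2 + b ^ 2" "q = x ^ 2 + y ^ 2" "odd a" "even y"
    and dvd: "q dvd x * b - y * a"
  shows "x ^ 2 = a ^ 2"
proof -
  have q: "q > 0" using prime_gt_0_int[OF assms(1)] .
  have odd_x: "odd x" using assms(2,4,6) by auto
  obtain t where t: "x * b - y * a = q * t" using dvd by blast
  have "(x * a + y * b) ^ 2 + (x * b - y * a) ^ 2 = (x ^ 2 + y ^ 2) * (a ^ 2 + b ^ 2)"
    by (simp add: power2_eq_square algebra_simps)
  also have "\<dots> = q ^ 2" using assms(3,4) by (simp add: power2_eq_square)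
  finally have id: "(x * a + y * b) ^ 2 + q ^ 2 * t ^ 2 = q ^ 2"
    by (simp add: t power_mult_distrib)
  have "odd (x * a + y * b)" using odd_x assms(5,6) by simp
  hence "x * a + y * b \<noteq> 0" by (metis even_zero)
  hence "(x * a + y * b) ^ 2 > 0" by simp
  hence "q ^ 2 * t ^ 2 < q ^ 2 * 1" using id by linarith
  hence "t ^ 2 < 1" using q by (simp only: mult_less_cancel_left_pos zero_less_power)
  hence "t = 0" by (simp add: abs_square_less_1)
  hence "x * b = y * a" using t by simp
  hence "x ^ 2 * b ^ 2 = y ^ 2 * a ^ 2" by (metis power_mult_distrib)
  hence "x ^ 2 * q = a ^ 2 * q"
    by (subst (1) assms(3), subst assms(4)) (simp add: algebra_simps)
  thus ?thesis using q by simp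
qed

text \<open>Modulo \<open>q\<close> the ratios \<open>x / y\<close> and \<open>a / b\<close> are both square roots of \<open>- 1\<close>, so \<open>q\<close> divides one of
  \<open>x b - y a\<close> and \<open>x b + y a\<close>; the second case becomes the first on replacing \<open>a\<close> by \<open>- a\<close>.\<close>
lemma sum_two_squares_unique:
  fixes a b x y :: int
  assumes "prime q" "odd q" "q = a ^ 2 + b ^ 2" "q = x ^ 2 + y ^ 2" "odd a" "even y"
  shows "x ^ 2 = a ^ 2"
proof -
  have "(x * b - y * a) * (x * b - y * (- a)) = x ^ 2 * b ^ 2 - y ^ 2 * a ^ 2"
    by (simp add: power2_eq_square algebra_simps)
  also have "\<dots> = (q - y ^ 2) * b ^ 2 - y ^ 2 * (q - b ^ 2)"
    using assms(3,4) by simp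
  also have "\<dots> = q * (b ^ 2 - y ^ 2)" by (simp add: algebra_simps)
  finally have "q dvd x * b - y * a \<or> q dvd x * b - y * (- a)"
    using assms(1) by (metis dvd_triv_left prime_dvd_mult_iff)
  thus ?thesis
    using sum_two_squares_unique_aux[OF assms(1-6)]
      sum_two_squares_unique_aux[of q "- a" b x y] assms by auto
qed


section \<open>Evaluation of the sum modulo p\<close>

context odd_prime
begin

lemma not_dvd_power_2: "\<not> int p dvd 2 ^ k"
proof
  assume "int p dvd 2 ^ k"
  hence "int p dvd 2" using prime_dvd_power[OF prime_int_p] by blast
  thus False using p_gt_2 by (auto dest: zdvd_imp_le)
qed

lemma power_16_cong_1: "[16 ^ (p - 1) = (1 :: int)] (mod int p)"
proof -
  have "chi (2 ^ 2 * 2 ^ 2) = 1"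
    unfolding chi_mult using chi_square[of "2 ^ 2"] not_dvd_power_2[of 2] by simp
  hence "[16 ^ m = (1 :: int)] (mod int p)" using chi_euler[of 16] by (simp add: cong_sym)
  from cong_pow[OF this, of 2] show ?thesis using p_eq by (simp add: power_mult mult.commute)
qed

lemma power_minus_4_cong_1:
  assumes "even m" shows "[(- 4) ^ m = (1 :: int)] (mod int p)"
proof -
  have "chi (- 1 * (2 * 2)) = 1"
    unfolding chi_mult using chi_square[of 2] chi_minus_1[OF assms] not_dvd_power_2[of 1] by simp
  thus ?thesis using chi_euler[of "- 4"] by (simp add: cong_sym)
qed

text \<open>Multiplying the sum by \<open>16^(p - 1)\<close> makes it an integer. After \<open>central_binomial_cong\<close> its terms carry the
  factor \<open>(- 4)^k * 16^(p - 1 - k) = (- 4)^(3 m) * (- 4)^(m - k)\<close>, as inversion requires.\<close>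
lemma cleared_sum_cong:
  "[(\<Sum>k=0..p-1. int ((2 * k) choose k) * int (S k) * 16 ^ (p - 1 - k)) =
    (- 4) ^ (3 * m) * int (mid_binomial m) ^ 2] (mod int p)"
proof -
  have "[(\<Sum>k=0..p-1. int ((2 * k) choose k) * int (S k) * 16 ^ (p - 1 - k)) =
      (\<Sum>k=0..p-1. (- 4) ^ k * int (m choose k) * int (S k) * 16 ^ (p - 1 - k))] (mod int p)"
    using p_gt_2 by (intro cong_sum cong_mult cong_refl central_binomial_cong) auto
  also have "(\<Sum>k=0..p-1. (- 4) ^ k * int (m choose k) * int (S k) * 16 ^ (p - 1 - k)) =
      (\<Sum>k\<le>m. (- 4) ^ k * int (m choose k) * int (S k) * 16 ^ (p - 1 - k))"
    using p_eq by (intro sum.mono_neutral_right) auto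
  also have "\<dots> = (\<Sum>k\<le>m. (- 4) ^ (3 * m) * (int (m choose k) * int (S k) * (- 4) ^ (m - k)))"
  proof (intro sum.cong refl)
    fix k assume "k \<in> {..m}"
    hence "k + 2 * (p - 1 - k) = 3 * m + (m - k)" using p_eq by simp
    hence "(- 4 :: int) ^ k * ((- 4) ^ 2) ^ (p - 1 - k) = (- 4) ^ (3 * m) * (- 4) ^ (m - k)"
      by (simp only: flip: power_add power_mult)
    hence "(- 4 :: int) ^ k * 16 ^ (p - 1 - k) = (- 4) ^ (3 * m) * (- 4) ^ (m - k)" by simp
    moreover have "(- 4) ^ k * int (m choose k) * int (S k) * 16 ^ (p - 1 - k) =
        ((- 4) ^ k * 16 ^ (p - 1 - k)) * (int (m choose k) * int (S k))"
      by (simp only: mult_ac)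
    ultimately show "(- 4) ^ k * int (m choose k) * int (S k) * 16 ^ (p - 1 - k) =
        (- 4) ^ (3 * m) * (int (m choose k) * int (S k) * (- 4) ^ (m - k))"
      by (simp only: mult_ac)
  qed
  also have "\<dots> = (- 4) ^ (3 * m) * int (mid_binomial m) ^ 2"
    by (simp only: S_binomial_inversion flip: sum_distrib_left)
  finally show ?thesis .
qed

lemma cleared_sum_cong_even:
  assumes "even m"
  shows "[(\<Sum>k=0..p-1. int ((2 * k) choose k) * int (S k) * 16 ^ (p - 1 - k)) =
    int (m choose (m div 2)) ^ 2] (mod int p)"
proof -
  have "[(- 4) ^ (3 * m) = (1 :: int)] (mod int p)"
    using cong_pow[OF power_minus_4_cong_1[OF assms], of 3] by (simp add: power_mult mult.commute)
  from cong_mult[OF this cong_refl] have "[(- 4) ^ (3 * m) * int (mid_binomial m) ^ 2 =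
      int (m choose (m div 2)) ^ 2] (mod int p)"
    using assms by (simp add: mid_binomial_def)
  thus ?thesis using cleared_sum_cong cong_trans by blast
qed

text \<open>Gauss's congruence for the middle binomial coefficient, squared so that the sign of \<open>a\<close> does not matter.\<close>
lemma jacobsthal_two_squares:
  assumes "even m"
  obtains a b :: int where "int p = a ^ 2 + b ^ 2" "odd a"
    "[int (m choose (m div 2)) ^ 2 = 4 * a ^ 2] (mod int p)"
proof -
  obtain n where n: "chi n = - 1" using nonresidueE by blast
  define a where "a = (\<Sum>x\<in>{1..int m}. chi x * chi (x ^ 2 + 1))"
  define b where "b = (\<Sum>x\<in>{1..int m}. chi x * chi (x ^ 2 + n))"
  have J: "jacobsthal 1 = 2 * a" "jacobsthal n = 2 * b"
    unfolding a_def b_def by (rule jacobsthal_eq_double[OF assms])+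
  have "int p = a ^ 2 + b ^ 2"
    using jacobsthal_sum_two_squares[OF assms n] by (simp add: J power_mult_distrib)
  moreover have "odd a" unfolding a_def by (rule odd_half_jacobsthal_1[OF assms])
  moreover have "[int (m choose (m div 2)) ^ 2 = 4 * a ^ 2] (mod int p)"
    using cong_sym[OF cong_pow[OF jacobsthal_1_cong[OF assms], of 2]] by (simp add: J power_mult_distrib)
  ultimately show ?thesis using that by blast
qed

end

section \<open>Congruences between rational numbers\<close>

lemma fraction_in_p_integers:
  assumes "prime p" "\<not> int p dvd d"
  shows "of_int z / of_int d \<in> p_integers p"
proof -
  obtain a b where ab: "quotient_of (of_int z / of_int d) = (a, b)" by force
  have "b > 0" "coprime a b" using ab quotient_of_denom_pos quotient_of_coprime by blast+
  have "d \<noteq> 0" using assms(2) by auto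
  have "of_int z / of_int d = (of_int a / of_int b :: rat)" using quotient_of_div[OF ab] .
  hence "of_int (z * b) = (of_int (a * d) :: rat)"
    using \<open>b > 0\<close> \<open>d \<noteq> 0\<close> by (simp add: field_simps)
  hence "a * d = z * b" by (simp only: of_int_eq_iff)
  hence "b dvd d" using \<open>coprime a b\<close> by (metis coprime_commute coprime_dvd_mult_right_iff dvd_triv_right)
  hence "\<not> int p dvd b" using assms(2) dvd_trans by blast
  thus ?thesis by (simp add: p_integers_def ab)
qed

lemma rat_cong_fraction:
  assumes "prime p" "\<not> int p dvd d" "[z = b * d] (mod int p)"
  shows "rat_cong p (of_int z / of_int d) (of_int b)"
proof -
  obtain c where c: "z - b * d = int p * c"
    using assms(3) by (auto simp: cong_iff_dvd_diff dvd_def)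
  have "d \<noteq> 0" using assms(2) by auto
  have "of_int z / of_int d - of_int b = (of_int (z - b * d) / of_int d :: rat)"
    using \<open>d \<noteq> 0\<close> by (simp add: field_simps)
  also have "\<dots> = of_nat p * (of_int c / of_int d)"
    unfolding c by simp
  finally have "of_int z / of_int d - of_int b = (of_nat p * (of_int c / of_int d) :: rat)" .
  moreover have "(of_int b :: rat) \<in> p_integers p"
    using fraction_in_p_integers[of p 1 b] assms(1) by (auto simp: prime_nat_iff)
  ultimately show ?thesis
    unfolding rat_cong_def using fraction_in_p_integers[OF assms(1,2)] by blast
qed

text \<open>As \<open>16^(p - 1)\<close> is congruent to \<open>1\<close>, clearing denominators with it does not change the residue class.\<close>
lemma (in odd_prime) rat_cong_sum:
  assumes "[(\<Sum>k=0..p-1. int ((2 * k) choose k) * int (S k) * 16 ^ (p - 1 - k)) = b] (mod int p)"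
  shows "rat_cong p (\<Sum>k=0..p-1. of_nat ((2 * k) choose k) * of_nat (S k) / 16 ^ k) (of_int b)"
proof -
  let ?z = "\<Sum>k=0..p-1. int ((2 * k) choose k) * int (S k) * 16 ^ (p - 1 - k)"
  have "(16 :: rat) ^ (p - 1) = 16 ^ (p - 1 - k) * 16 ^ k" if "k \<le> p - 1" for k
    using that by (simp flip: power_add)
  hence "of_nat ((2 * k) choose k) * of_nat (S k) / (16 :: rat) ^ k =
      of_nat ((2 * k) choose k) * of_nat (S k) * 16 ^ (p - 1 - k) / 16 ^ (p - 1)"
    if "k \<in> {0..p-1}" for k
    using that by simp
  hence "(\<Sum>k=0..p-1. of_nat ((2 * k) choose k) * of_nat (S k) / (16 :: rat) ^ k) =
      (\<Sum>k=0..p-1. of_nat ((2 * k) choose k) * of_nat (S k) * 16 ^ (p - 1 - k) / 16 ^ (p - 1))"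
    by (rule sum.cong[OF refl])
  also have "\<dots> = of_int ?z / of_int (16 ^ (p - 1))"
    by (simp flip: sum_divide_distrib)
  finally have sum_eq: "(\<Sum>k=0..p-1. of_nat ((2 * k) choose k) * of_nat (S k) / (16 :: rat) ^ k) =
      of_int ?z / of_int (16 ^ (p - 1))" .
  have "\<not> int p dvd 1" using p_gt_2 by simp
  hence "\<not> int p dvd 16 ^ (p - 1)" using cong_dvd_iff[OF power_16_cong_1] by simp
  moreover have "[b = b * 16 ^ (p - 1)] (mod int p)"
    using cong_sym[OF cong_scalar_left[OF power_16_cong_1, of b]] by (simp only: mult_1_right)
  hence "[?z = b * 16 ^ (p - 1)] (mod int p)" by (rule cong_trans[OF assms])
  ultimately show ?thesis
    unfolding sum_eq by (intro rat_cong_fraction prime_p)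
qed

theorem theorem3p3:
  fixes p :: nat
  assumes "prime p" and "odd p"
  shows "([p = 1] (mod 4) \<longrightarrow>
            (\<exists>x y :: int. int p = x^2 + 4 * y^2) \<and>
            (\<forall>x y :: int. int p = x^2 + 4 * y^2 \<longrightarrow>
               rat_cong p (\<Sum>k=0..p-1. of_nat ((2 * k) choose k) * of_nat (S k) / 16 ^ k)
                          (of_int (4 * x^2)))) \<and>
         ([p = 3] (mod 4) \<longrightarrow>
            rat_cong p (\<Sum>k=0..p-1. of_nat ((2 * k) choose k) * of_nat (S k) / 16 ^ k) 0)"
proof -
  obtain m where "p = 2 * m + 1" using \<open>odd p\<close> by (rule oddE)
  then interpret odd_prime p m using \<open>prime p\<close> by unfold_locales
  show ?thesis
  proof (intro conjI impI)
    assume "[p = 3] (mod 4)"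
    hence "odd m" using p_eq unfolding cong_def by presburger
    hence "mid_binomial m = 0" by (simp add: mid_binomial_def)
    thus "rat_cong p (\<Sum>k=0..p-1. of_nat ((2 * k) choose k) * of_nat (S k) / 16 ^ k) 0"
      using rat_cong_sum[of 0] cleared_sum_cong by simp
  next
    assume "[p = 1] (mod 4)"
    hence m: "even m" using p_eq unfolding cong_def by presburger
    from jacobsthal_two_squares[OF m] obtain a b :: int where ab: "int p = a ^ 2 + b ^ 2" "odd a"
      and C: "[int (m choose (m div 2)) ^ 2 = 4 * a ^ 2] (mod int p)" by blast
    have "odd (int p)" using odd_p by simp
    hence "even b" using ab by simp
    then obtain c where "b = 2 * c" by blast
    hence "int p = a ^ 2 + 4 * c ^ 2" using ab(1) by (simp add: power_mult_distrib)
    thus "\<exists>x y :: int. int p = x^2 + 4 * y^2" by blast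
    show "\<forall>x y :: int. int p = x^2 + 4 * y^2 \<longrightarrow>
        rat_cong p (\<Sum>k=0..p-1. of_nat ((2 * k) choose k) * of_nat (S k) / 16 ^ k) (of_int (4 * x^2))"
    proof (intro allI impI)
      fix x y :: int assume "int p = x^2 + 4 * y^2"
      hence rep: "int p = x ^ 2 + (2 * y) ^ 2" by (simp add: power_mult_distrib)
      have sq: "x ^ 2 = a ^ 2"
        by (rule sum_two_squares_unique[OF prime_int_p \<open>odd (int p)\<close> ab(1) rep ab(2)]) simp
      show "rat_cong p (\<Sum>k=0..p-1. of_nat ((2 * k) choose k) * of_nat (S k) / 16 ^ k) (of_int (4 * x^2))"
        unfolding sq
        by (rule rat_cong_sum[OF cong_trans[OF cleared_sum_cong_even[OF m] C]])
    qed
  qed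
qed

end
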